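(* Let $p$ be an odd prime, $n,x\in\mathbb{Z}_p$ and $n(n+4x)\not\equiv 0\pmod p$. Then $$\sum_{k=0}^{p-1}\binom{2k}{k}\frac{C_k(x)}{(n+4x)^k}\equiv\left(\frac{n(n+4x)}{p}\right)\sum_{k=0}^{p-1}\frac{\binom{2k}{k}\binom{3k}{k}\binom{6k}{3k}}{n^{3k}}\pmod p.$$
   Context: $\mathbb{Z}_p$ denotes the set of rational numbers whose denominator is not divisible by $p$; congruences modulo $p$ are taken in this ring. $\left(\frac{a}{p}\right)$ is the Legendre symbol, which for $a\in\mathbb{Z}_p$ is the Legendre symbol of the residue of $a$ modulo $p$. For nonnegative integers $m$, $C_m(x)=\sum_{k=0}^{\lfloor m/3\rfloor}\binom{2k}{k}\binom{3k}{k}\binom{m}{3k}x^{m-3k}$ (with $x^0=1$). *)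

theory Defs
  imports "HOL-Number_Theory.Number_Theory"
begin

definition Zp :: "nat \<Rightarrow> rat set" where
  "Zp p = {a. \<not> int p dvd snd (quotient_of a)}"

text \<open>
  Congruence modulo \<open>p\<close> in the ring \<^term>\<open>Zp p\<close>: the difference lies in the ideal
  generated by \<open>p\<close>. The library's \<^const>\<open>cong\<close> is not usable here, since on a field it
  would refer to the ideals of the field itself.
\<close>

definition Zp_cong :: "nat \<Rightarrow> rat \<Rightarrow> rat \<Rightarrow> bool" where
  "Zp_cong p a b \<longleftrightarrow> (\<exists>c\<in>Zp p. a - b = of_nat p * c)"

definition Zp_residue :: "nat \<Rightarrow> rat \<Rightarrow> int" where
  "Zp_residue p a = (THE r. 0 \<le> r \<and> r < int p \<and> Zp_cong p a (of_int r))"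

definition Zp_Legendre :: "nat \<Rightarrow> rat \<Rightarrow> int" where
  "Zp_Legendre p a = Legendre (Zp_residue p a) (int p)"

definition C_poly :: "nat \<Rightarrow> rat \<Rightarrow> rat" where
  "C_poly m x = (\<Sum>k = 0..m div 3.
     of_nat ((2 * k choose k) * (3 * k choose k) * (m choose (3 * k))) * x ^ (m - 3 * k))"

text \<open>The description in \<^const>\<open>Zp_residue\<close> is proper for every element of \<^term>\<open>Zp p\<close>.\<close>

lemma Zp_iff:
  assumes "prime p"
  shows "a \<in> Zp p \<longleftrightarrow> (\<exists>u v. \<not> int p dvd v \<and> a = of_int u / of_int v)"
proof
  assume a: "a \<in> Zp p"
  obtain u v where uv: "quotient_of a = (u, v)" by fastforce
  with a have "\<not> int p dvd v" by (simp add: Zp_def)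
  with quotient_of_div[OF uv] show "\<exists>u v. \<not> int p dvd v \<and> a = of_int u / of_int v" by blast
next
  assume "\<exists>u v. \<not> int p dvd v \<and> a = of_int u / of_int v"
  then obtain u v where v: "\<not> int p dvd v" and a: "a = of_int u / of_int v" by blast
  obtain s t where st: "quotient_of a = (s, t)" by fastforce
  have t: "t > 0" using quotient_of_denom_pos[OF st] .
  have v0: "v \<noteq> 0" using v by auto
  have "(of_int (u * t) :: rat) = of_int (s * v)"
    using quotient_of_div[OF st] a t v0 by (simp add: field_simps)
  then have eq: "u * t = s * v" using of_int_eq_iff by blast
  have "\<not> int p dvd t"
  proof
    assume pt: "int p dvd t"
    have p: "prime (int p)" using assms by simp
    from pt eq have "int p dvd s * v" by (metis dvd_mult)
    with p v have ps: "int p dvd s" using prime_dvd_mult_iff by blast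
    have "coprime s t" using quotient_of_coprime[OF st] .
    with ps pt have "is_unit (int p)" using coprime_common_divisor by blast
    with p show False using not_prime_unit by blast
  qed
  then show "a \<in> Zp p" by (simp add: Zp_def st)
qed

lemma Zp_residue_unique:
  assumes p: "prime p" and a: "a \<in> Zp p"
  shows "\<exists>!r. 0 \<le> r \<and> r < int p \<and> Zp_cong p a (of_int r)"
proof -
  have p': "prime (int p)" using p by simp
  have p0: "int p > 0" using p prime_gt_0_nat by simp
  obtain u v where v: "\<not> int p dvd v" and auv: "a = of_int u / of_int v"
    using a Zp_iff[OF p] by blast
  have v0: "v \<noteq> 0" using v by auto
  have key: "Zp_cong p a (of_int r) \<longleftrightarrow> int p dvd u - r * v" for r
  proof
    assume "Zp_cong p a (of_int r)"
    then obtain c where c: "c \<in> Zp p" and e: "a - of_int r = of_nat p * c"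
      by (auto simp: Zp_cong_def)
    obtain s t where t: "\<not> int p dvd t" and cst: "c = of_int s / of_int t"
      using c Zp_iff[OF p] by blast
    have t0: "t \<noteq> 0" using t by auto
    have "(of_int ((u - r * v) * t) :: rat) = of_int (int p * (s * v))"
      using e v0 t0 unfolding auv cst by (simp add: field_simps)
    then have "(u - r * v) * t = int p * (s * v)" using of_int_eq_iff by blast
    then have "int p dvd (u - r * v) * t" by simp
    with t p' show "int p dvd u - r * v" using prime_dvd_mult_iff by blast
  next
    assume "int p dvd u - r * v"
    then obtain w where w: "u - r * v = int p * w" by blast
    have "(of_int (u - r * v) :: rat) = of_int (int p * w)" using w by simp
    then have "a - of_int r = of_nat p * (of_int w / of_int v)"
      using v0 unfolding auv by (simp add: field_simps)
    moreover have "of_int w / of_int v \<in> Zp p" using v Zp_iff[OF p] by blast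
    ultimately show "Zp_cong p a (of_int r)" unfolding Zp_cong_def by blast
  qed
  have "coprime v (int p)" using p' v by (metis coprime_commute prime_imp_coprime)
  then obtain w where w: "[v * w = 1] (mod int p)" using cong_solve_coprime_int by blast
  let ?r = "(u * w) mod int p"
  have "[?r * v = u * w * v] (mod int p)" by (simp add: cong_def mod_mult_left_eq)
  also have "u * w * v = u * (v * w)" by (simp add: ac_simps)
  also have "[u * (v * w) = u * 1] (mod int p)" by (rule cong_scalar_left[OF w])
  finally have "[u = ?r * v] (mod int p)" by (simp add: cong_sym_eq)
  then have "int p dvd u - ?r * v" by (simp add: cong_iff_dvd_diff)
  then have ex: "0 \<le> ?r \<and> ?r < int p \<and> Zp_cong p a (of_int ?r)" using key p0 by simp
  show ?thesis
  proof (rule ex1I, rule ex)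
    fix r assume r: "0 \<le> r \<and> r < int p \<and> Zp_cong p a (of_int r)"
    have "int p dvd (u - ?r * v) - (u - r * v)" using key ex r dvd_diff by blast
    also have "(u - ?r * v) - (u - r * v) = (r - ?r) * v" by (simp add: algebra_simps)
    finally have "int p dvd r - ?r" using p' v prime_dvd_mult_iff by blast
    then have "[r = ?r] (mod int p)" by (simp add: cong_iff_dvd_diff)
    then show "r = ?r" using r ex by (metis cong_less_imp_eq_int)
  qed
qed

end

theory Submission
  imports Defs
begin

text \<open>
  Write \<open>m = n + 4 * x\<close>, \<open>h = (p - 1) div 2\<close> and
  \<open>c j = (2 * j choose j) * (3 * j choose j)\<close>. Since \<open>h\<close> is congruent to \<open>- 1 / 2\<close>, the
  identity \<open>(2 * k choose k) = (- 4) ^ k * (- 1 / 2 gchoose k)\<close> becomes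
  \<open>(2 * k choose k) \<equiv> (- 4) ^ k * (h choose k)\<close> modulo \<open>p\<close> for \<open>k < p\<close>
  (\<open>central_binomial_cong\<close>). This truncates both sums at a fixed degree, and what is left of the
  left-hand side, \<open>\<Sum>k. (h choose k) * (- 4 / m) ^ k * C_poly k x\<close>, is a binomial transform
  that can be evaluated exactly over the rationals.

  By trinomial revision and the binomial theorem,
  \<open>\<Sum>k. (h choose k) * (k choose i) * y ^ k * x ^ (k - i)\<close> equals
  \<open>(h choose i) * y ^ i * (1 + x * y) ^ (h - i)\<close>. At \<open>y = - 4 / m\<close> the base
  \<open>1 + x * y\<close> is \<open>n / m\<close>, so the powers of \<open>m\<close> attached to \<open>i = 3 * j\<close> cancel and the
  transform is \<open>(n / m) ^ h * (\<Sum>j. c j * (- 4) ^ (3 * j) * (h choose (3 * j)) / n ^ (3 * j))\<close>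
  (\<open>C_poly_transform_at_quotient\<close>).

  Read backwards, the congruence for central binomial coefficients turns
  \<open>(- 4) ^ (3 * j) * (h choose (3 * j))\<close> into \<open>(6 * j choose (3 * j))\<close> as long as
  \<open>3 * j < p\<close>. For the other \<open>j\<close> below \<open>p\<close> the factor \<open>c j = fact (3 * j) / fact j ^ 3\<close>
  is divisible by \<open>p\<close>, so both terms vanish (\<open>six_binomial_cong\<close>). The prefactor
  \<open>(n / m) ^ h\<close> differs from \<open>(n * m) ^ h\<close> by \<open>m ^ (p - 1)\<close>, which is congruent to
  \<open>1\<close>, and Euler's criterion identifies it with the Legendre symbol
  (\<open>Zp_Legendre_mult_cong\<close>).
\<close>

section \<open>Congruences in the local ring\<close>

lemma Zp_of_int: "prime p \<Longrightarrow> of_int a \<in> Zp p"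
  by (auto simp: Zp_def dest: prime_gt_1_nat)

lemma Zp_of_nat: "prime p \<Longrightarrow> of_nat a \<in> Zp p"
  using Zp_of_int[of p "int a"] by simp

lemma Zp_mult:
  assumes "prime p" "a \<in> Zp p" "b \<in> Zp p"
  shows "a * b \<in> Zp p"
proof -
  obtain u v s t where "\<not> int p dvd v" "a = of_int u / of_int v"
    "\<not> int p dvd t" "b = of_int s / of_int t"
    using assms by (auto simp: Zp_iff)
  then have "a * b = of_int (u * s) / of_int (v * t)" "\<not> int p dvd v * t"
    using assms(1) by (auto simp: prime_dvd_mult_iff)
  then show ?thesis using Zp_iff[OF assms(1)] by blast
qed

lemma Zp_add:
  assumes "prime p" "a \<in> Zp p" "b \<in> Zp p"
  shows "a + b \<in> Zp p"
proof -
  obtain u v s t where *: "\<not> int p dvd v" "a = of_int u / of_int v"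
    "\<not> int p dvd t" "b = of_int s / of_int t"
    using assms by (auto simp: Zp_iff)
  moreover from * have "v \<noteq> 0" "t \<noteq> 0" by auto
  ultimately have "a + b = of_int (u * t + s * v) / of_int (v * t)" "\<not> int p dvd v * t"
    using assms(1) by (auto simp: prime_dvd_mult_iff field_simps)
  then show ?thesis using Zp_iff[OF assms(1)] by blast
qed

lemma Zp_power: "prime p \<Longrightarrow> a \<in> Zp p \<Longrightarrow> a ^ k \<in> Zp p"
  using Zp_of_int[of p 1] by (induction k) (auto intro: Zp_mult)

lemma Zp_sum: "prime p \<Longrightarrow> (\<And>i. i \<in> I \<Longrightarrow> f i \<in> Zp p) \<Longrightarrow> sum f I \<in> Zp p"
  using Zp_of_int[of p 0] by (induction I rule: infinite_finite_induct) (auto intro: Zp_add)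

lemma Zp_cong_refl: "prime p \<Longrightarrow> Zp_cong p a a"
  using Zp_of_int[of p 0] by (auto simp: Zp_cong_def)

lemma Zp_cong_add:
  assumes "prime p" "Zp_cong p a b" "Zp_cong p c d"
  shows "Zp_cong p (a + c) (b + d)"
proof -
  obtain s t where "s \<in> Zp p" "t \<in> Zp p" "a - b = of_nat p * s" "c - d = of_nat p * t"
    using assms by (auto simp: Zp_cong_def)
  then have "s + t \<in> Zp p" "(a + c) - (b + d) = of_nat p * (s + t)"
    using Zp_add[OF assms(1)] by (auto simp: algebra_simps)
  then show ?thesis unfolding Zp_cong_def by blast
qed

lemma Zp_cong_mult_left:
  assumes "prime p" "c \<in> Zp p" "Zp_cong p a b"
  shows "Zp_cong p (c * a) (c * b)"
proof -
  obtain s where "s \<in> Zp p" "a - b = of_nat p * s"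
    using assms by (auto simp: Zp_cong_def)
  then have "c * s \<in> Zp p" "c * a - c * b = of_nat p * (c * s)"
    using Zp_mult[OF assms(1,2)] by (simp_all add: mult.left_commute flip: right_diff_distrib)
  then show ?thesis unfolding Zp_cong_def by blast
qed

lemma Zp_cong_sym:
  assumes "prime p" "Zp_cong p a b"
  shows "Zp_cong p b a"
  using Zp_cong_add[OF assms(1) Zp_cong_refl[OF assms(1), of "a + b"]
      Zp_cong_mult_left[OF assms(1) Zp_of_int[OF assms(1), of "- 1"] assms(2)]]
  by simp

lemma Zp_cong_trans:
  assumes "prime p" "Zp_cong p a b" "Zp_cong p b c"
  shows "Zp_cong p a c"
proof -
  have "Zp_cong p (- b + (a + b)) (- b + (b + c))"
    by (intro Zp_cong_add Zp_cong_refl assms)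
  then show ?thesis by simp
qed

lemma Zp_cong_mult:
  assumes "prime p" "c \<in> Zp p" "b \<in> Zp p" "Zp_cong p a b" "Zp_cong p c d"
  shows "Zp_cong p (a * c) (b * d)"
proof (rule Zp_cong_trans[OF assms(1)])
  show "Zp_cong p (a * c) (b * c)"
    using Zp_cong_mult_left[OF assms(1,2,4)] by (simp add: mult.commute)
  show "Zp_cong p (b * c) (b * d)"
    using assms by (intro Zp_cong_mult_left)
qed

lemma Zp_cong_power:
  assumes "prime p" "a \<in> Zp p" "b \<in> Zp p" "Zp_cong p a b"
  shows "Zp_cong p (a ^ k) (b ^ k)"
  by (induction k) (auto intro!: Zp_cong_mult Zp_cong_refl Zp_power assms)

lemma Zp_cong_sum:
  assumes "prime p" "\<And>i. i \<in> I \<Longrightarrow> Zp_cong p (f i) (g i)"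
  shows "Zp_cong p (sum f I) (sum g I)"
  using assms(2)
  by (induction I rule: infinite_finite_induct) (auto intro: Zp_cong_add Zp_cong_refl assms(1))

lemma Zp_cong_of_int:
  assumes "prime p" "[a = b] (mod int p)"
  shows "Zp_cong p (of_int a) (of_int b)"
proof -
  obtain c where "a - b = int p * c"
    using assms(2) by (auto simp: cong_iff_dvd_diff)
  then have "(of_int (a - b) :: rat) = of_int (int p * c)" by (rule arg_cong)
  then show ?thesis
    unfolding Zp_cong_def using Zp_of_int[OF assms(1)] by (intro bexI[of _ "of_int c"]) simp_all
qed

text \<open>A fraction of \<^term>\<open>Zp p\<close> whose numerator is divisible by \<open>p\<close> lies in the maximal
  ideal; so outside that ideal numerator and denominator can trade places.\<close>

lemma Zp_inverse:
  assumes "prime p" "a \<in> Zp p" "\<not> Zp_cong p a 0"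
  shows "inverse a \<in> Zp p" "a \<noteq> 0"
proof -
  obtain u v where a: "\<not> int p dvd v" "a = of_int u / of_int v"
    using assms by (auto simp: Zp_iff)
  have "\<not> int p dvd u"
  proof
    assume "int p dvd u"
    then obtain w where "u = int p * w" by blast
    then have "a - 0 = of_nat p * (of_int w / of_int v)" using a by simp
    moreover have "of_int w / of_int v \<in> Zp p" using a Zp_iff[OF assms(1)] by blast
    ultimately show False using assms(3) unfolding Zp_cong_def by blast
  qed
  moreover have "inverse a = of_int v / of_int u" using a by simp
  ultimately show "inverse a \<in> Zp p" using Zp_iff[OF assms(1)] by blast
  show "a \<noteq> 0" using assms Zp_cong_refl by metis
qed

section \<open>The Legendre symbol\<close>

lemma Zp_cong_residue:
  assumes "prime p" "a \<in> Zp p"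
  shows "Zp_cong p a (of_int (Zp_residue p a))" "0 \<le> Zp_residue p a"
  using theI'[OF Zp_residue_unique[OF assms]] unfolding Zp_residue_def by blast+

lemma Zp_euler_criterion:
  assumes "prime p" "odd p" "a \<in> Zp p"
  shows "Zp_cong p (a ^ ((p - 1) div 2)) (of_int (Zp_Legendre p a))"
proof (rule Zp_cong_trans[OF assms(1)])
  let ?r = "Zp_residue p a" and ?h = "(p - 1) div 2"
  show "Zp_cong p (a ^ ?h) (of_int (?r ^ ?h))"
    unfolding of_int_power
    by (intro Zp_cong_power Zp_of_int Zp_cong_residue assms)
  have "2 < p" using assms prime_ge_2_nat[of p] by (cases "p = 2") auto
  then have "[Legendre ?r (int p) = ?r ^ ?h] (mod int p)"
    using assms(1) by (intro euler_criterion)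
  then show "Zp_cong p (of_int (?r ^ ?h)) (of_int (Zp_Legendre p a))"
    unfolding Zp_Legendre_def using assms(1) by (intro Zp_cong_of_int) (auto simp: cong_sym)
qed

lemma Zp_fermat:
  assumes "prime p" "a \<in> Zp p" "\<not> Zp_cong p a 0"
  shows "Zp_cong p (a ^ (p - 1)) 1"
proof (rule Zp_cong_trans[OF assms(1)])
  let ?r = "Zp_residue p a"
  have cong: "Zp_cong p a (of_int ?r)" using assms by (intro Zp_cong_residue)
  then show "Zp_cong p (a ^ (p - 1)) (of_int (?r ^ (p - 1)))"
    unfolding of_int_power by (intro Zp_cong_power Zp_of_int assms)
  have "\<not> int p dvd ?r"
    using Zp_cong_of_int[OF assms(1), of ?r 0] Zp_cong_trans[OF assms(1) cong, of 0] assms(3)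
    by (auto simp: cong_0_iff)
  moreover obtain r where r: "?r = int r"
    using Zp_cong_residue(2)[OF assms(1,2)] nonneg_int_cases by blast
  ultimately have "[r ^ (p - 1) = 1] (mod p)"
    using assms(1) by (intro fermat_theorem) auto
  then have "[?r ^ (p - 1) = 1] (mod int p)"
    unfolding r by (metis cong_int_iff of_nat_1 of_nat_power)
  from Zp_cong_of_int[OF assms(1) this]
  show "Zp_cong p (of_int (?r ^ (p - 1))) 1" by simp
qed

text \<open>Replacing \<open>a * b\<close> by \<open>a / b\<close> divides by a square, which does not change the quadratic
  character.\<close>

lemma Zp_Legendre_mult_cong:
  assumes "prime p" "odd p" "a \<in> Zp p" "b \<in> Zp p" "\<not> Zp_cong p b 0"
  shows "Zp_cong p ((a / b) ^ ((p - 1) div 2)) (of_int (Zp_Legendre p (a * b)))"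
proof (rule Zp_cong_trans[OF assms(1)])
  let ?h = "(p - 1) div 2"
  note b = Zp_inverse[OF assms(1,4,5)]
  have ab: "a / b \<in> Zp p"
    using Zp_mult[OF assms(1,3) b(1)] by (simp add: divide_inverse)
  have "(a * b) ^ ?h = (a / b) ^ ?h * b ^ (?h + ?h)"
    using b(2) by (simp add: power_add field_simps)
  also have "?h + ?h = p - 1" using assms(2) by (auto elim!: oddE)
  finally have eq: "(a * b) ^ ?h = (a / b) ^ ?h * b ^ (p - 1)" .
  have "Zp_cong p ((a / b) ^ ?h * b ^ (p - 1)) ((a / b) ^ ?h * 1)"
    by (intro Zp_cong_mult_left Zp_fermat Zp_power ab assms)
  then show "Zp_cong p ((a / b) ^ ?h) ((a * b) ^ ?h)"
    unfolding eq using Zp_cong_sym[OF assms(1)] by simp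
  show "Zp_cong p ((a * b) ^ ?h) (of_int (Zp_Legendre p (a * b)))"
    by (intro Zp_euler_criterion Zp_mult assms)
qed

section \<open>Central binomial coefficients modulo an odd prime\<close>

lemma Suc_times_central_binomial:
  "Suc k * (2 * Suc k choose Suc k) = 2 * (2 * k + 1) * (2 * k choose k)"
proof -
  have 1: "Suc k * (2 * Suc k choose Suc k) = (2 * k + 2) * (2 * k + 1 choose k)"
    using Suc_times_binomial_eq[of "2 * k + 1" k] by (simp add: mult.commute)
  have 2: "Suc k * (2 * k + 1 choose Suc k) = (2 * k + 1) * (2 * k choose k)"
    using Suc_times_binomial_eq[of "2 * k" k] by (simp add: mult.commute)
  have "(2 * k + 1 choose k) = (2 * k + 1 choose Suc k)"
    using binomial_symmetric[of k "2 * k + 1"] by simp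
  with 1 have "Suc k * (2 * Suc k choose Suc k) = 2 * (Suc k * (2 * k + 1 choose Suc k))"
    by (simp del: binomial_Suc_Suc)
  with 2 show ?thesis by (simp only: mult.assoc)
qed

text \<open>Both sides satisfy the same first-order recurrence modulo \<open>p\<close>: passing from \<open>k\<close> to
  \<open>Suc k\<close> multiplies the left side by \<open>2 * (2 * k + 1) / Suc k\<close> and the right side by
  \<open>- 4 * (h - k) / Suc k\<close> with \<open>h = (p - 1) div 2\<close>, and these numerators differ by
  \<open>2 * p\<close>. The bound on \<open>k\<close> keeps the denominators invertible.\<close>

lemma central_binomial_cong:
  assumes "prime p" "odd p" "k < p"
  shows "[int (2 * k choose k) = (- 4) ^ k * int ((p - 1) div 2 choose k)] (mod int p)"
  using assms(3)
proof (induction k)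
  case 0
  then show ?case by simp
next
  case (Suc k)
  let ?h = "(p - 1) div 2"
  have h: "2 * int ?h = int p - 1" using assms(2) by (auto elim!: oddE)
  have step: "int (Suc k) * int (?h choose Suc k) = (int ?h - int k) * int (?h choose k)"
  proof (cases "k \<le> ?h")
    case True
    then show ?thesis
      using binomial_absorb_comp[of ?h k] binomial_absorption[of k ?h]
      by (metis of_nat_diff of_nat_mult)
  next
    case False
    then show ?thesis by (simp add: binomial_eq_0)
  qed
  have "int (Suc k) * int (2 * Suc k choose Suc k) = 2 * (2 * int k + 1) * int (2 * k choose k)"
    using arg_cong[OF Suc_times_central_binomial, of int k]
    by (simp only: of_nat_mult of_nat_add of_nat_numeral of_nat_1)
  also have "[\<dots> = 2 * (2 * int k + 1) * ((- 4) ^ k * int (?h choose k))] (mod int p)"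
    using Suc by (intro cong_mult cong_refl) auto
  also have "[2 * (2 * int k + 1) * ((- 4) ^ k * int (?h choose k)) =
    - 4 * (int ?h - int k) * ((- 4) ^ k * int (?h choose k))] (mod int p)"
  proof (rule cong_mult[OF _ cong_refl])
    have "2 * (2 * int k + 1) - - 4 * (int ?h - int k) = 2 * int p" using h by simp
    then show "[2 * (2 * int k + 1) = - 4 * (int ?h - int k)] (mod int p)"
      by (simp only: cong_iff_dvd_diff dvd_triv_right)
  qed
  also have "- 4 * (int ?h - int k) * ((- 4) ^ k * int (?h choose k)) =
    int (Suc k) * ((- 4) ^ Suc k * int (?h choose Suc k))"
    unfolding power_Suc mult.left_commute[of "int (Suc k)"] step by (simp only: mult_ac)
  finally have "[int (Suc k) * int (2 * Suc k choose Suc k) =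
    int (Suc k) * ((- 4) ^ Suc k * int (?h choose Suc k))] (mod int p)" .
  moreover have "coprime (int (Suc k)) (int p)"
    using Suc.prems assms(1)
    by (metis coprime_commute coprime_int_iff dvd_imp_le not_less prime_imp_coprime zero_less_Suc)
  ultimately show ?case using cong_mult_lcancel by blast
qed

text \<open>The product is the multinomial coefficient \<open>fact (3 * j) / fact j ^ 3\<close>, in which only the
  numerator contains the prime.\<close>

lemma prime_dvd_trinomial:
  assumes "prime p" "j < p" "p \<le> 3 * j"
  shows "p dvd (2 * j choose j) * (3 * j choose j)"
proof -
  have "fact j * fact j * (2 * j choose j) = (fact (2 * j) :: nat)"
    "fact j * fact (2 * j) * (3 * j choose j) = (fact (3 * j) :: nat)"
    using binomial_fact_lemma[of j "2 * j"] binomial_fact_lemma[of j "3 * j"] by simp_all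
  then have "fact (3 * j) = ((2 * j choose j) * (3 * j choose j)) * (fact j * fact j * fact j :: nat)"
    by (metis mult.assoc mult.commute)
  moreover have "p dvd fact (3 * j)" "\<not> p dvd fact j"
    using assms by (auto simp: prime_dvd_fact_iff)
  ultimately show ?thesis using assms(1) by (simp add: prime_dvd_mult_iff)
qed

text \<open>The congruence for central binomial coefficients at \<open>3 * j\<close> requires \<open>3 * j < p\<close>. The
  factor \<open>c\<close> extends its range to all \<open>j < p\<close>, because it vanishes modulo \<open>p\<close> when
  \<open>3 * j\<close> is too large.\<close>

lemma six_binomial_cong:
  assumes "prime p" "odd p" "j < p"
  defines "c \<equiv> (2 * j choose j) * (3 * j choose j)"
  shows "[int (c * (6 * j choose (3 * j))) =
    int c * ((- 4) ^ (3 * j) * int ((p - 1) div 2 choose (3 * j)))] (mod int p)"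
proof (cases "3 * j < p")
  case True
  from central_binomial_cong[OF assms(1,2) this] show ?thesis
    by (simp add: cong_scalar_left)
next
  case False
  then have "int p dvd int c" using prime_dvd_trinomial[OF assms(1,3)] by (simp only: c_def int_dvd_int_iff)
  then have "int p dvd int c * a" for a by (rule dvd_mult2)
  then show ?thesis by (metis cong_0_iff cong_sym cong_trans of_nat_mult)
qed

section \<open>Binomial transforms of the polynomials\<close>

text \<open>Trinomial revision rewrites \<open>(h choose k) * (k choose i)\<close> as
  \<open>(h choose i) * (h - i choose (k - i))\<close>; then the binomial theorem applies. Any summation
  bound \<open>N\<close> from \<open>h\<close> on gives the same sum, so one bound can serve for all \<open>i\<close> and for the
  outer sum.\<close>

lemma binomial_transform_shifted:
  fixes x y :: "'a :: comm_ring_1"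
  assumes "h \<le> N"
  shows "(\<Sum>k = 0..N. of_nat (h choose k) * y ^ k * (of_nat (k choose i) * x ^ (k - i))) =
    of_nat (h choose i) * y ^ i * (1 + x * y) ^ (h - i)"
proof (cases "i \<le> h")
  case True
  have "(\<Sum>k = 0..N. of_nat (h choose k) * y ^ k * (of_nat (k choose i) * x ^ (k - i))) =
    (\<Sum>k = i..h. of_nat (h choose k) * y ^ k * (of_nat (k choose i) * x ^ (k - i)))"
    using assms by (intro sum.mono_neutral_right) (auto simp: not_le binomial_eq_0)
  also have "\<dots> = (\<Sum>k = 0..h - i.
    of_nat (h choose (k + i)) * y ^ (k + i) * (of_nat ((k + i) choose i) * x ^ k))"
    using sum.shift_bounds_cl_nat_ivl[of "\<lambda>k. of_nat (h choose k) * y ^ k *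
      (of_nat (k choose i) * x ^ (k - i))" 0 i "h - i"] True by simp
  also have "\<dots> = (\<Sum>k = 0..h - i.
    of_nat (h choose i) * y ^ i * (of_nat (h - i choose k) * (x * y) ^ k))"
  proof (rule sum.cong[OF refl])
    fix k assume "k \<in> {0..h - i}"
    then have "(h choose (k + i)) * ((k + i) choose i) = (h choose i) * (h - i choose k)"
      using choose_mult[of i "k + i" h] True by simp
    from arg_cong[OF this, of "of_nat :: nat \<Rightarrow> 'a"]
    have "of_nat (h choose (k + i)) * of_nat ((k + i) choose i) =
      (of_nat (h choose i) * of_nat (h - i choose k) :: 'a)" by simp
    then show "of_nat (h choose (k + i)) * y ^ (k + i) * (of_nat ((k + i) choose i) * x ^ k) =
      of_nat (h choose i) * y ^ i * (of_nat (h - i choose k) * (x * y) ^ k)"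
      by (simp add: power_add power_mult_distrib mult_ac)
  qed
  also have "\<dots> = of_nat (h choose i) * y ^ i * (1 + x * y) ^ (h - i)"
    using binomial_ring[of "x * y" 1 "h - i"]
    by (simp add: sum_distrib_left atLeast0AtMost add.commute)
  finally show ?thesis .
next
  case False
  then have "(h choose k) = 0 \<or> (k choose i) = 0" for k by (simp add: binomial_eq_0_iff) linarith
  then have "(of_nat (h choose k) * y ^ k * (of_nat (k choose i) * x ^ (k - i)) :: 'a) = 0" for k
    by (metis mult_zero_left mult_zero_right of_nat_0)
  then show ?thesis using False by (simp add: binomial_eq_0)
qed

text \<open>A summation range independent of \<open>k\<close> lets sums over \<open>k\<close> and \<open>j\<close> be interchanged.
  The additional terms contain \<open>(k choose (3 * j))\<close> with \<open>3 * j > k\<close>.\<close>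

lemma C_poly_extend:
  assumes "k \<le> N"
  shows "C_poly k x = (\<Sum>j = 0..N.
    of_nat ((2 * j choose j) * (3 * j choose j)) * (of_nat (k choose (3 * j)) * x ^ (k - 3 * j)))"
  unfolding C_poly_def of_nat_mult mult.assoc
  using assms by (intro sum.mono_neutral_left) (auto simp: binomial_eq_0_iff)

lemma C_poly_binomial_transform:
  assumes "h \<le> N"
  shows "(\<Sum>k = 0..N. of_nat (h choose k) * y ^ k * C_poly k x) =
    (\<Sum>j = 0..N. of_nat ((2 * j choose j) * (3 * j choose j)) *
      (of_nat (h choose (3 * j)) * y ^ (3 * j) * (1 + x * y) ^ (h - 3 * j)))"
proof -
  have "(\<Sum>k = 0..N. of_nat (h choose k) * y ^ k * C_poly k x) =
    (\<Sum>k = 0..N. \<Sum>j = 0..N. of_nat ((2 * j choose j) * (3 * j choose j)) *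
      (of_nat (h choose k) * y ^ k * (of_nat (k choose (3 * j)) * x ^ (k - 3 * j))))"
    by (intro sum.cong refl) (simp add: C_poly_extend[of _ N] sum_distrib_left mult_ac)
  also have "\<dots> = (\<Sum>j = 0..N. of_nat ((2 * j choose j) * (3 * j choose j)) *
    (\<Sum>k = 0..N. of_nat (h choose k) * y ^ k * (of_nat (k choose (3 * j)) * x ^ (k - 3 * j))))"
    by (subst sum.swap) (simp add: sum_distrib_left)
  finally show ?thesis by (simp only: binomial_transform_shifted[OF assms])
qed

text \<open>The argument \<open>- 4 / (n + 4 * x)\<close> makes \<open>1 + x * y\<close> equal to the quotient
  \<open>n / (n + 4 * x)\<close>, and then the dependence on \<open>n + 4 * x\<close> leaves the sum as one
  common power.\<close>

lemma C_poly_transform_at_quotient: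
  assumes "h \<le> N" "n \<noteq> 0" "n + 4 * x \<noteq> 0"
  shows "(\<Sum>k = 0..N. of_nat (h choose k) * (- 4 / (n + 4 * x)) ^ k * C_poly k x) =
    (n / (n + 4 * x)) ^ h *
      (\<Sum>j = 0..N. of_nat ((2 * j choose j) * (3 * j choose j)) *
        ((- 4) ^ (3 * j) * of_nat (h choose (3 * j))) / n ^ (3 * j))"
proof -
  define m where "m = n + 4 * x"
  have m: "m \<noteq> 0" using assms by (simp add: m_def)
  have nm: "1 + x * (- 4 / m) = n / m" using m by (simp add: m_def field_simps)
  have "of_nat (h choose (3 * j)) * (- 4 / m) ^ (3 * j) * (n / m) ^ (h - 3 * j) =
    (n / m) ^ h * ((- 4) ^ (3 * j) * of_nat (h choose (3 * j)) / n ^ (3 * j))" for j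
  proof (cases "3 * j \<le> h")
    case True
    then have "(n / m) ^ h = (n / m) ^ (3 * j) * (n / m) ^ (h - 3 * j)"
      by (simp flip: power_add)
    moreover have "(- 4 / m) ^ (3 * j) = (n / m) ^ (3 * j) * ((- 4) ^ (3 * j) / n ^ (3 * j))"
      using assms by (simp only: power_divide) simp
    ultimately show ?thesis by simp
  qed (simp add: binomial_eq_0)
  then show ?thesis
    unfolding C_poly_binomial_transform[OF assms(1)] m_def[symmetric] nm
    by (simp add: sum_distrib_left mult_ac)
qed

section \<open>The congruence\<close>

theorem theorem4p1:
  fixes p :: nat and n x :: rat
  assumes "prime p" and "odd p"
    and "n \<in> Zp p" and "x \<in> Zp p"
    and "\<not> Zp_cong p (n * (n + 4 * x)) 0"
  shows "Zp_cong p
    (\<Sum>k = 0..p - 1. of_nat (2 * k choose k) * C_poly k x / (n + 4 * x) ^ k)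
    (of_int (Zp_Legendre p (n * (n + 4 * x))) *
      (\<Sum>k = 0..p - 1.
        of_nat ((2 * k choose k) * (3 * k choose k) * (6 * k choose (3 * k))) / n ^ (3 * k)))"
proof -
  note p = assms(1) and odd = assms(2) and n = assms(3) and x = assms(4)
  define m where "m = n + 4 * x"
  define h where "h = (p - 1) div 2"
  have p1: "p \<ge> 1" using p prime_ge_1_nat by blast
  have m: "m \<in> Zp p"
    unfolding m_def using Zp_of_int[OF p, of 4] by (intro Zp_add Zp_mult p n x) simp
  have nu: "\<not> Zp_cong p n 0" and mu: "\<not> Zp_cong p m 0"
    using assms(5)[folded m_def] Zp_cong_mult_left[OF p m, of n 0] Zp_cong_mult_left[OF p n, of m 0]
    by (auto simp: mult.commute)
  note n' = Zp_inverse[OF p n nu] and m' = Zp_inverse[OF p m mu]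
  have C: "C_poly k x \<in> Zp p" for k
    unfolding C_poly_def by (intro Zp_sum Zp_mult Zp_of_nat Zp_power p x)

  \<comment> \<open>\<open>S\<close> is the middle term: the left side is \<open>(n / m) ^ h * S\<close> modulo \<open>p\<close>, and the sum
    \<open>T\<close> of the right side is congruent to \<open>S\<close> term by term.\<close>
  define S where "S = (\<Sum>j = 0..p - 1. of_nat ((2 * j choose j) * (3 * j choose j)) *
    ((- 4) ^ (3 * j) * of_nat (h choose (3 * j))) / n ^ (3 * j))"
  define T where "T = (\<Sum>k = 0..p - 1.
    of_nat ((2 * k choose k) * (3 * k choose k) * (6 * k choose (3 * k))) / n ^ (3 * k))"

  have "Zp_cong p (\<Sum>k = 0..p - 1. of_nat (2 * k choose k) * C_poly k x / m ^ k)
    (\<Sum>k = 0..p - 1. of_nat (h choose k) * (- 4 / m) ^ k * C_poly k x)"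
  proof (rule Zp_cong_sum[OF p])
    fix k assume "k \<in> {0..p - 1}"
    then have "k < p" using p1 by auto
    have "Zp_cong p (inverse m ^ k * C_poly k x * of_int (int (2 * k choose k)))
      (inverse m ^ k * C_poly k x * of_int ((- 4) ^ k * int (h choose k)))"
      unfolding h_def
      by (intro Zp_cong_mult_left Zp_mult Zp_power Zp_cong_of_int central_binomial_cong
          p odd m' C \<open>k < p\<close>)
    then show "Zp_cong p (of_nat (2 * k choose k) * C_poly k x / m ^ k)
      (of_nat (h choose k) * (- 4 / m) ^ k * C_poly k x)"
      by (simp only: divide_inverse power_mult_distrib mult_ac power_inverse of_int_mult
          of_int_power of_int_neg_numeral of_int_of_nat_eq)
  qed
  also have "(\<Sum>k = 0..p - 1. of_nat (h choose k) * (- 4 / m) ^ k * C_poly k x) = (n / m) ^ h * S"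
    unfolding S_def m_def using n'(2) m'(2)
    by (intro C_poly_transform_at_quotient) (auto simp: h_def m_def)
  finally have left: "Zp_cong p (\<Sum>k = 0..p - 1. of_nat (2 * k choose k) * C_poly k x / m ^ k)
    ((n / m) ^ h * S)" .

  have TS: "Zp_cong p T S"
    unfolding T_def S_def
  proof (rule Zp_cong_sum[OF p])
    fix j assume "j \<in> {0..p - 1}"
    then have "j < p" using p1 by auto
    have "Zp_cong p
      (inverse n ^ (3 * j) * of_int (int ((2 * j choose j) * (3 * j choose j) * (6 * j choose (3 * j)))))
      (inverse n ^ (3 * j) * of_int (int ((2 * j choose j) * (3 * j choose j)) *
        ((- 4) ^ (3 * j) * int (h choose (3 * j)))))"
      unfolding h_def
      by (intro Zp_cong_mult_left Zp_power Zp_cong_of_int six_binomial_cong p odd n' \<open>j < p\<close>)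
    then show "Zp_cong p
      (of_nat ((2 * j choose j) * (3 * j choose j) * (6 * j choose (3 * j))) / n ^ (3 * j))
      (of_nat ((2 * j choose j) * (3 * j choose j)) *
        ((- 4) ^ (3 * j) * of_nat (h choose (3 * j))) / n ^ (3 * j))"
      by (simp add: divide_inverse mult_ac power_inverse)
  qed
  have "T \<in> Zp p"
    unfolding T_def divide_inverse power_inverse[symmetric]
    by (intro Zp_sum Zp_mult Zp_of_nat Zp_power p n')
  have "Zp_cong p (of_int (Zp_Legendre p (n * m)) * T) ((n / m) ^ h * S)"
    unfolding h_def
    using TS \<open>T \<in> Zp p\<close> p odd n m mu m'(1) Zp_Legendre_mult_cong[THEN Zp_cong_sym[OF p]]
    by (intro Zp_cong_mult) (auto simp: divide_inverse intro!: Zp_power Zp_mult)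
  then show ?thesis
    using Zp_cong_trans[OF p left Zp_cong_sym[OF p]] unfolding T_def m_def by blast
qed

end
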